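(* The semi-infinite problem $$\min_{\mathbf{x}}\ \mathbf{c}^t\mathbf{x}\quad\text{s.t. } A_1\mathbf{x}\le \mathbf{b}_1,\ \ (A_2+\lambda D)\mathbf{x}\le \mathbf{b}_2\ \ \forall \lambda\in[\lambda_1,\lambda_2],\ \ \mathbf{x}\in\mathbb{R}^{n_c}\times\mathbb{Z}^{n_i}$$ is equivalent to the finite problem $$\min_{\mathbf{x}}\ \mathbf{c}^t\mathbf{x}\quad\text{s.t. } A_1\mathbf{x}\le \mathbf{b}_1,\ \ A_2\mathbf{x}+\lambda_1 D\mathbf{x}\le \mathbf{b}_2,\ \ A_2\mathbf{x}+\lambda_2 D\mathbf{x}\le \mathbf{b}_2,\ \ \mathbf{x}\in\mathbb{R}^{n_c}\times\mathbb{Z}^{n_i}$$ (that is, the two problems have the same feasible set and the same objective), and the optimal value of the latter is an upper bound on $f(\lambda)$ for every $\lambda\in[\lambda_1,\lambda_2]$.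
   Context: Let $n=n_c+n_i$, $\mathbf{c}\in\mathbb{R}^n$, $A_1\in\mathbb{R}^{m_1\times n}$, $A_2,D\in\mathbb{R}^{m_2\times n}$, $\mathbf{b}_1\in\mathbb{R}^{m_1}$, $\mathbf{b}_2\in\mathbb{R}^{m_2}$, and real numbers $\lambda_1\le\lambda_2$. Vector inequalities are componentwise. For $\lambda\in\mathbb{R}$, let $f(\lambda)$ be the optimal value (infimum, in $\mathbb{R}\cup\{\pm\infty\}$, equal to $+\infty$ if infeasible) of $$\mathcal{P}(\lambda):\ \min\ \mathbf{c}^t\mathbf{x}\ \text{ s.t. } A_1\mathbf{x}\le\mathbf{b}_1,\ A_2\mathbf{x}+\lambda D\mathbf{x}\le\mathbf{b}_2,\ \mathbf{x}\in\mathbb{R}^{n_c}\times\mathbb{Z}^{n_i}.$$ Optimal values of the other problems follow the same convention. *)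

theory Defs
  imports "Jordan_Normal_Form.Matrix" "HOL-Library.Extended_Real"
begin

datatype 'a min_problem = Min_Problem (objective: "'a \<Rightarrow> real") (feasible: "'a set")

text \<open>In \<^typ>\<open>ereal\<close> the infimum over the empty set is \<open>\<infinity>\<close>, so infeasible problems have
  optimal value \<open>\<infinity>\<close>, and unbounded ones have optimal value \<open>-\<infinity>\<close>.\<close>

definition optimal_value :: "'a min_problem \<Rightarrow> ereal" where
  "optimal_value P = (INF x\<in>feasible P. ereal (objective P x))"

definition equivalent_problems :: "'a min_problem \<Rightarrow> 'a min_problem \<Rightarrow> bool" where
  "equivalent_problems P Q \<longleftrightarrow> feasible P = feasible Q \<and> objective P = objective Q"

text \<open>The integer variables are the last \<open>ni\<close> ones.\<close>

definition mixed_integer_vec :: "nat \<Rightarrow> nat \<Rightarrow> real vec set" where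
  "mixed_integer_vec nc ni =
     {x \<in> carrier_vec (nc + ni). \<forall>i\<in>{nc..<nc + ni}. x $ i \<in> \<int>}"

text \<open>On \<^typ>\<open>real vec\<close>, the relation \<open>\<le>\<close> is the componentwise order (and requires equal dimensions).
  The parameter \<open>\<lambda>\<close> is written \<open>\<mu>\<close>.\<close>

definition parametric_problem ::
  "nat \<Rightarrow> nat \<Rightarrow> real vec \<Rightarrow> real mat \<Rightarrow> real vec \<Rightarrow> real mat \<Rightarrow> real mat \<Rightarrow> real vec
    \<Rightarrow> real \<Rightarrow> real vec min_problem" where
  "parametric_problem nc ni c A1 b1 A2 D b2 \<mu> =
     Min_Problem (\<lambda>x. c \<bullet> x)
       {x \<in> mixed_integer_vec nc ni.
          A1 *\<^sub>v x \<le> b1 \<and> A2 *\<^sub>v x + \<mu> \<cdot>\<^sub>v (D *\<^sub>v x) \<le> b2}"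

definition semi_infinite_problem ::
  "nat \<Rightarrow> nat \<Rightarrow> real vec \<Rightarrow> real mat \<Rightarrow> real vec \<Rightarrow> real mat \<Rightarrow> real mat \<Rightarrow> real vec
    \<Rightarrow> real \<Rightarrow> real \<Rightarrow> real vec min_problem" where
  "semi_infinite_problem nc ni c A1 b1 A2 D b2 \<mu>1 \<mu>2 =
     Min_Problem (\<lambda>x. c \<bullet> x)
       {x \<in> mixed_integer_vec nc ni.
          A1 *\<^sub>v x \<le> b1 \<and> (\<forall>\<mu>\<in>{\<mu>1..\<mu>2}. (A2 + \<mu> \<cdot>\<^sub>m D) *\<^sub>v x \<le> b2)}"

definition finite_problem ::
  "nat \<Rightarrow> nat \<Rightarrow> real vec \<Rightarrow> real mat \<Rightarrow> real vec \<Rightarrow> real mat \<Rightarrow> real mat \<Rightarrow> real vec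
    \<Rightarrow> real \<Rightarrow> real \<Rightarrow> real vec min_problem" where
  "finite_problem nc ni c A1 b1 A2 D b2 \<mu>1 \<mu>2 =
     Min_Problem (\<lambda>x. c \<bullet> x)
       {x \<in> mixed_integer_vec nc ni.
          A1 *\<^sub>v x \<le> b1 \<and>
          A2 *\<^sub>v x + \<mu>1 \<cdot>\<^sub>v (D *\<^sub>v x) \<le> b2 \<and>
          A2 *\<^sub>v x + \<mu>2 \<cdot>\<^sub>v (D *\<^sub>v x) \<le> b2}"

end

theory Submission
  imports Defs
begin

text \<open>For a fixed \<open>x\<close>, each row of
  \<open>A2 *\<^sub>v x + \<mu> \<cdot>\<^sub>v (D *\<^sub>v x)\<close> is an affine function of
  \<mu>, so on an interval it is largest at an endpoint. The constraints for all \<mu> in the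
  interval therefore reduce to those at \<open>\<mu>1\<close> and \<open>\<mu>2\<close>
  (\<open>affine_vec_le_between\<close>). By the same argument, each point feasible for the finite
  problem is feasible for every parametric problem in the interval, and an infimum can only drop
  when the feasible set grows.\<close>

lemma smult_mat_mult_vec:
  fixes A :: "'a::comm_semiring_0 mat"
  assumes "A \<in> carrier_mat m n" and "x \<in> carrier_vec n"
  shows "(k \<cdot>\<^sub>m A) *\<^sub>v x = k \<cdot>\<^sub>v (A *\<^sub>v x)"
  using assms by (intro eq_vecI) (auto simp: scalar_prod_def sum_distrib_left mult.assoc)

text \<open>The sign of the slope \<open>d\<close> decides which endpoint dominates:
  \<open>u\<close> if \<open>d\<close> is nonnegative, \<open>l\<close> otherwise.\<close>

lemma affine_le_between:
  fixes a b d :: "'a::linordered_idom"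
  assumes "l \<le> t" "t \<le> u" "a + l * d \<le> b" "a + u * d \<le> b"
  shows "a + t * d \<le> b"
proof (cases "0 \<le> d")
  case True
  then have "t * d \<le> u * d" using assms by (intro mult_right_mono)
  then show ?thesis using assms(4) by (meson add_left_mono order_trans)
next
  case False
  then have "t * d \<le> l * d" using assms by (intro mult_right_mono_neg) auto
  then show ?thesis using assms(3) by (meson add_left_mono order_trans)
qed

text \<open>The scalar bound holds in each coordinate. A vector sum takes the dimension of its
  second summand, here that of \<open>d\<close> throughout, so the dimension condition inside \<le>
  carries over.\<close>

lemma affine_vec_le_between:
  fixes a b d :: "'a::linordered_idom vec"
  assumes "l \<le> t" "t \<le> u" "a + l \<cdot>\<^sub>v d \<le> b" "a + u \<cdot>\<^sub>v d \<le> b"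
  shows "a + t \<cdot>\<^sub>v d \<le> b"
  using assms affine_le_between[OF assms(1,2)] by (auto simp: less_eq_vec_def)

theorem theorem1:
  fixes nc ni m1 m2 :: nat
    and c b1 b2 :: "real vec"
    and A1 A2 D :: "real mat"
    and \<mu>1 \<mu>2 :: real
  assumes "c \<in> carrier_vec (nc + ni)"
    and "A1 \<in> carrier_mat m1 (nc + ni)"
    and "A2 \<in> carrier_mat m2 (nc + ni)"
    and "D \<in> carrier_mat m2 (nc + ni)"
    and "b1 \<in> carrier_vec m1"
    and "b2 \<in> carrier_vec m2"
    and "\<mu>1 \<le> \<mu>2"
  shows "equivalent_problems
           (semi_infinite_problem nc ni c A1 b1 A2 D b2 \<mu>1 \<mu>2)
           (finite_problem nc ni c A1 b1 A2 D b2 \<mu>1 \<mu>2) \<and>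
         (\<forall>\<mu>\<in>{\<mu>1..\<mu>2}.
           optimal_value (parametric_problem nc ni c A1 b1 A2 D b2 \<mu>)
             \<le> optimal_value (finite_problem nc ni c A1 b1 A2 D b2 \<mu>1 \<mu>2))"
proof
  \<comment> \<open>The semi-infinite problem combines the matrices before multiplying, the other
    two problems afterwards; this identity reconciles the two forms.\<close>
  have split: "(A2 + \<mu> \<cdot>\<^sub>m D) *\<^sub>v x = A2 *\<^sub>v x + \<mu> \<cdot>\<^sub>v (D *\<^sub>v x)"
    if "x \<in> mixed_integer_vec nc ni" for \<mu> x
    using that assms(3,4)
    by (simp add: mixed_integer_vec_def add_mult_distrib_mat_vec[of _ m2 "nc + ni"]
        smult_mat_mult_vec[of _ m2 "nc + ni"])
  have "feasible (semi_infinite_problem nc ni c A1 b1 A2 D b2 \<mu>1 \<mu>2) =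
        feasible (finite_problem nc ni c A1 b1 A2 D b2 \<mu>1 \<mu>2)"
    \<comment> \<open>This inequality puts both endpoints in the interval, which gives the inclusion
      from left to right.\<close>
    using \<open>\<mu>1 \<le> \<mu>2\<close>
    by (auto simp: semi_infinite_problem_def finite_problem_def split
        intro: affine_vec_le_between)
  then show "equivalent_problems
      (semi_infinite_problem nc ni c A1 b1 A2 D b2 \<mu>1 \<mu>2)
      (finite_problem nc ni c A1 b1 A2 D b2 \<mu>1 \<mu>2)"
    by (simp add: equivalent_problems_def semi_infinite_problem_def finite_problem_def)
  show "\<forall>\<mu>\<in>{\<mu>1..\<mu>2}.
      optimal_value (parametric_problem nc ni c A1 b1 A2 D b2 \<mu>)
        \<le> optimal_value (finite_problem nc ni c A1 b1 A2 D b2 \<mu>1 \<mu>2)"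
    unfolding optimal_value_def
    \<comment> \<open>The objectives agree, so only the inclusion of the feasible sets remains; in
      \<open>ereal\<close> this also covers infeasible and unbounded problems.\<close>
    by (intro ballI INF_superset_mono)
      (auto simp: parametric_problem_def finite_problem_def intro: affine_vec_le_between)
qed

end
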